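(* Fix $\rho_{\mathrm{base}}\in\mathbb{R}$. The prosumers' game, i.e. the $N$-player noncooperative game in which each prosumer $n\in\mathcal{N}$ chooses $x_n\in\mathcal{X}_n=[x_{n,\min},x_{n,\max}]$ to maximize its expected utility $U^{\mathrm{CGT}}_n(x_n,\boldsymbol{x}_{-n},\rho_{\mathrm{base}})$, admits a unique pure-strategy Nash equilibrium.
   Context: Let $\mathcal{N}$ be a finite set of $N\ge 1$ prosumers. Each prosumer $n\in\mathcal{N}$ has real parameters $W_n$ (produced energy), $Q_n$ (initial stored energy), $L_n$ (load), and storage capacity $Q_{\max,n}\ge 0$. Its action $x_n$ (energy bought if positive, sold if negative) ranges over $\mathcal{X}_n=[x_{n,\min},x_{n,\max}]$, where $x_{n,\min}=-W_n-Q_n+L_n$ and $x_{n,\max}=-W_n-Q_n+L_n+Q_{\max,n}$. Let $\alpha>0$ be a fixed constant, $\rho_{\mathrm{base}}\in\mathbb{R}$ the (fixed) base price announced by the power company, and $\rho_f$ a random future price uniformly distributed on $[\rho_{\min},\rho_{\max}]$. Write $\boldsymbol{x}_{-n}$ for the actions of the prosumers other than $n$. The utility of prosumer $n$ is $$U_n(x_n,\boldsymbol{x}_{-n},\rho_{\mathrm{base}})=-\Big(\rho_{\mathrm{base}}+\alpha\big(x_n+\sum_{m\in\mathcal{N}\setminus\{n\}}x_m\big)\Big)x_n+(W_n+Q_n-L_n+x_n)\rho_f,$$ and its expected utility is $U^{\mathrm{CGT}}_n:=\mathbb{E}_{\rho_f}[U_n]$. A pure-strategy Nash equilibrium is a profile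 $\boldsymbol{x}^*\in\prod_{n}\mathcal{X}_n$ such that $U^{\mathrm{CGT}}_n(x_n^*,\boldsymbol{x}_{-n}^*,\rho_{\mathrm{base}})\ge U^{\mathrm{CGT}}_n(x_n,\boldsymbol{x}_{-n}^*,\rho_{\mathrm{base}})$ for all $n\in\mathcal{N}$ and all $x_n\in\mathcal{X}_n$. *)

theory Defs
  imports "HOL-Probability.Probability"
begin

text \<open>A strategic game is given by a player set \<open>N\<close>, action sets \<open>S n\<close> and payoffs
  \<open>u n a y\<close>, where \<open>a\<close> is the action of \<open>n\<close> and \<open>y\<close> is the profile of the other players,
  a function that is \<^term>\<open>undefined\<close> outside \<open>N - {n}\<close>. Profiles are extensional functions on
  \<open>N\<close>, so that equality of profiles is equality on \<open>N\<close>.\<close>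

definition pure_nash_equilibrium ::
  "'i set \<Rightarrow> ('i \<Rightarrow> 'a set) \<Rightarrow> ('i \<Rightarrow> 'a \<Rightarrow> ('i \<Rightarrow> 'a) \<Rightarrow> real) \<Rightarrow> ('i \<Rightarrow> 'a) \<Rightarrow> bool" where
  "pure_nash_equilibrium N S u x \<longleftrightarrow>
     x \<in> (\<Pi>\<^sub>E n\<in>N. S n) \<and>
     (\<forall>n\<in>N. \<forall>a\<in>S n. u n (x n) (restrict x (N - {n})) \<ge> u n a (restrict x (N - {n})))"

definition x_min :: "('i \<Rightarrow> real) \<Rightarrow> ('i \<Rightarrow> real) \<Rightarrow> ('i \<Rightarrow> real) \<Rightarrow> 'i \<Rightarrow> real" where
  "x_min W Q L n = - W n - Q n + L n"

definition x_max ::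
  "('i \<Rightarrow> real) \<Rightarrow> ('i \<Rightarrow> real) \<Rightarrow> ('i \<Rightarrow> real) \<Rightarrow> ('i \<Rightarrow> real) \<Rightarrow> 'i \<Rightarrow> real" where
  "x_max W Q L Qmax n = - W n - Q n + L n + Qmax n"

definition action_set ::
  "('i \<Rightarrow> real) \<Rightarrow> ('i \<Rightarrow> real) \<Rightarrow> ('i \<Rightarrow> real) \<Rightarrow> ('i \<Rightarrow> real) \<Rightarrow> 'i \<Rightarrow> real set" where
  "action_set W Q L Qmax n = {x_min W Q L n .. x_max W Q L Qmax n}"

definition utility ::
  "'i set \<Rightarrow> ('i \<Rightarrow> real) \<Rightarrow> ('i \<Rightarrow> real) \<Rightarrow> ('i \<Rightarrow> real) \<Rightarrow> real \<Rightarrow> real \<Rightarrow> real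
    \<Rightarrow> 'i \<Rightarrow> real \<Rightarrow> ('i \<Rightarrow> real) \<Rightarrow> real" where
  "utility N W Q L \<alpha> \<rho>base \<rho>future n a y =
     - (\<rho>base + \<alpha> * (a + (\<Sum>m\<in>N - {n}. y m))) * a + (W n + Q n - L n + a) * \<rho>future"

definition expected_utility ::
  "'b measure \<Rightarrow> ('b \<Rightarrow> real) \<Rightarrow> 'i set \<Rightarrow> ('i \<Rightarrow> real) \<Rightarrow> ('i \<Rightarrow> real) \<Rightarrow> ('i \<Rightarrow> real)
    \<Rightarrow> real \<Rightarrow> real \<Rightarrow> 'i \<Rightarrow> real \<Rightarrow> ('i \<Rightarrow> real) \<Rightarrow> real" where
  "expected_utility M \<rho>f N W Q L \<alpha> \<rho>base n a y =
     prob_space.expectation M (\<lambda>\<omega>. utility N W Q L \<alpha> \<rho>base (\<rho>f \<omega>) n a y)"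

end

theory Submission
  imports Defs
begin

text \<open>The best response of prosumer \<open>n\<close> to the aggregate action \<open>T\<close> of all prosumers
  (\<open>n\<close> included) is the projection of \<open>k - T\<close> onto its action interval, where
  \<open>k = (E[\<rho>f] - \<rho>base) / \<alpha>\<close>. Equilibria therefore correspond to the fixed points of the sum
  of these projections, a continuous nonincreasing function of \<open>T\<close>, which has exactly one
  fixed point.\<close>

text \<open>The density is bounded and vanishes off a compact interval. This ensures that the
  expected price is a genuine mean.\<close>

lemma uniform_integrable:
  assumes d: "distributed M lborel X (\<lambda>r. indicator {a..b} r / measure lborel {a..b})"
  shows "integrable M (X :: 'b \<Rightarrow> real)"
proof -
  have "integrable lborel (\<lambda>x. indicator {a..b} x / measure lborel {a..b} * x :: real)"
    using integrable_mult_left[OF borel_integrable_atLeastAtMost[of a b "\<lambda>x. x"],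
        of "1 / measure lborel {a..b}"]
    by (simp add: indicator_def if_distrib if_distribR mult.commute cong: if_cong)
  then show ?thesis
    using distributed_integrable[OF d, of "\<lambda>x. x"] by (simp add: measure_nonneg)
qed

text \<open>Utility is affine in the price, so taking expectations replaces the price by its
  mean.\<close>

lemma expected_utility_eq:
  assumes "prob_space M" and "integrable M \<rho>f"
  shows "expected_utility M \<rho>f N W Q L \<alpha> \<rho>base n a y =
     - (\<rho>base + \<alpha> * (a + (\<Sum>m\<in>N - {n}. y m))) * a
     + (W n + Q n - L n + a) * prob_space.expectation M \<rho>f"
proof -
  interpret prob_space M by fact
  show ?thesis
    unfolding expected_utility_def utility_def using assms(2) by (simp add: prob_space)
qed

text \<open>The midpoint of \<open>x\<close> and the projection of \<open>k - s - x\<close> improves on \<open>x\<close> unless both coincide.\<close>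
lemma quadratic_maximum_iff:
  fixes k s l u x :: real
  assumes x: "x \<in> {l..u}"
  shows "(\<forall>a\<in>{l..u}. (k - s - a) * a \<le> (k - s - x) * x) \<longleftrightarrow> x = max l (min u (k - s - x))"
proof
  define t where "t = k - s - x"
  define p where "p = max l (min u t)"
  \<comment> \<open>Exact second-order expansion at \<open>x\<close>: \<open>t - x\<close> is the
    derivative of \<open>(k - s - a) * a\<close> at \<open>a = x\<close>.\<close>
  have gain: "(k - s - x) * x - (k - s - a) * a = (x - a) * (t - x) + (x - a)\<^sup>2" for a
    unfolding t_def by (simp add: algebra_simps power2_eq_square)
  {
    assume opt: "\<forall>a\<in>{l..u}. (k - s - a) * a \<le> (k - s - x) * x"
    \<comment> \<open>Testing \<open>a = p\<close> would only give
      \<open>(p - x) * (t - x) \<le> (p - x)\<^sup>2\<close>, which is compatible with the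
      projection inequality below. Halving the step gains the factor 2 that forces
      \<open>p = x\<close>.\<close>
    have "(x + p) / 2 \<in> {l..u}"
      using x by (auto simp: p_def)
    then have "0 \<le> (x - (x + p) / 2) * (t - x) + (x - (x + p) / 2)\<^sup>2"
      using opt gain[of "(x + p) / 2"] by fastforce
    then have "2 * ((p - x) * (t - x)) \<le> (p - x)\<^sup>2"
      by (simp add: field_simps power2_eq_square)
    \<comment> \<open>Variational inequality for \<open>p\<close> as the projection of
      \<open>t\<close> onto an interval containing \<open>x\<close>.\<close>
    moreover have "0 \<le> (p - x) * (t - p)"
      using x by (auto simp: p_def max_def min_def zero_le_mult_iff)
    then have "(p - x)\<^sup>2 \<le> (p - x) * (t - x)"
      by (simp add: algebra_simps power2_eq_square)
    ultimately have "(p - x)\<^sup>2 \<le> 0"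
      using zero_le_power2[of "p - x"] by linarith
    then show "x = max l (min u (k - s - x))"
      by (simp add: p_def t_def)
  next
    assume "x = max l (min u (k - s - x))"
    then have "0 \<le> (x - a) * (t - x)" if "a \<in> {l..u}" for a
      using that x by (auto simp: t_def max_def min_def zero_le_mult_iff split: if_splits)
    then show "\<forall>a\<in>{l..u}. (k - s - a) * a \<le> (k - s - x) * x"
      using gain by (smt (verit) zero_le_power2)
  }
qed

text \<open>Each projection lies between \<open>l n\<close> and \<open>u n\<close>, so
  \<open>?F T - T\<close> changes sign between \<open>sum l N\<close> and \<open>sum u N\<close>.
  For fixed points \<open>T' \<le> T\<close>, monotonicity gives
  \<open>T = ?F T \<le> ?F T' = T'\<close>.\<close>

lemma ex1_fixed_point_sum_projections:
  fixes l u :: "'i \<Rightarrow> real" and k :: real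
  assumes lu: "\<And>n. n \<in> N \<Longrightarrow> l n \<le> u n"
  shows "\<exists>!T. T = (\<Sum>n\<in>N. max (l n) (min (u n) (k - T)))"
proof (rule ex_ex1I)
  let ?F = "\<lambda>T. \<Sum>n\<in>N. max (l n) (min (u n) (k - T))"
  have "\<exists>T\<ge>sum l N. T \<le> sum u N \<and> ?F T - T = 0"
  proof (rule IVT2')
    show "?F (sum u N) - sum u N \<le> 0"
      using lu by (auto intro!: sum_mono)
    show "0 \<le> ?F (sum l N) - sum l N"
      by (auto intro!: sum_mono)
    show "sum l N \<le> sum u N"
      using lu by (rule sum_mono)
    show "continuous_on {sum l N..sum u N} (\<lambda>T. ?F T - T)"
      by (intro continuous_intros)
  qed
  then show "\<exists>T. T = ?F T"
    by (metis eq_iff_diff_eq_0)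
next
  let ?F = "\<lambda>T. \<Sum>n\<in>N. max (l n) (min (u n) (k - T))"
  have mono: "?F T \<le> ?F T'" if "T' \<le> T" for T T'
    using that by (intro sum_mono) auto
  fix T T' assume "T = ?F T" "T' = ?F T'"
  then show "T = T'"
    using mono[of T T'] mono[of T' T] by linarith
qed

text \<open>The best response is kept implicit, with \<open>x n\<close> also inside
  \<open>sum x N\<close>: this way all players are coupled through one common scalar.\<close>

lemma nash_iff_fixed_point:
  fixes N :: "'i set" and W Q L Qmax x :: "'i \<Rightarrow> real" and M :: "'b measure"
    and \<rho>base :: real
  assumes fin: "finite N" and \<alpha>: "\<alpha> > 0"
    and M: "prob_space M" and int: "integrable M \<rho>f"
  defines "k \<equiv> (prob_space.expectation M \<rho>f - \<rho>base) / \<alpha>"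
  shows "pure_nash_equilibrium N (action_set W Q L Qmax)
           (expected_utility M \<rho>f N W Q L \<alpha> \<rho>base) x \<longleftrightarrow>
         x \<in> (\<Pi>\<^sub>E n\<in>N. action_set W Q L Qmax n) \<and>
         (\<forall>n\<in>N. x n = max (x_min W Q L n) (min (x_max W Q L Qmax n) (k - sum x N)))"
proof -
  let ?U = "expected_utility M \<rho>f N W Q L \<alpha> \<rho>base"
  have "(\<forall>a\<in>action_set W Q L Qmax n.
            ?U n (x n) (restrict x (N - {n})) \<ge> ?U n a (restrict x (N - {n}))) \<longleftrightarrow>
        x n = max (x_min W Q L n) (min (x_max W Q L Qmax n) (k - sum x N))"
    if n: "n \<in> N" and xn: "x n \<in> action_set W Q L Qmax n" for n
  proof -
    define s where "s = sum x (N - {n})"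
    have S: "sum x N = x n + s"
      unfolding s_def using fin n by (rule sum.remove)
    \<comment> \<open>Up to the positive factor \<open>\<alpha>\<close> and a term independent of
      \<open>a\<close>, the payoff is the quadratic treated above.\<close>
    have U: "?U n a (restrict x (N - {n})) =
        \<alpha> * ((k - s - a) * a) + (W n + Q n - L n) * prob_space.expectation M \<rho>f" for a
      using \<alpha> by (simp add: expected_utility_eq[OF M int] s_def k_def field_simps)
    have t: "k - s - x n = k - sum x N"
      by (simp add: S)
    then show ?thesis
      using \<alpha> quadratic_maximum_iff[of "x n" "x_min W Q L n" "x_max W Q L Qmax n" k s] xn
      by (simp add: U action_set_def t)
  qed
  then show ?thesis
    unfolding pure_nash_equilibrium_def by (auto simp del: atLeastAtMost_iff dest: PiE_mem)
qed

theorem theorem2: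
  fixes N :: "'i set"
    and W Q L Qmax :: "'i \<Rightarrow> real"
    and \<alpha> \<rho>base \<rho>min \<rho>max :: real
    and M :: "'b measure"
    and \<rho>f :: "'b \<Rightarrow> real"
  assumes "finite N" and "N \<noteq> {}"
    and "\<And>n. n \<in> N \<Longrightarrow> Qmax n \<ge> 0"
    and "\<alpha> > 0"
    and "prob_space M"
    and "\<rho>min < \<rho>max"
    and "distributed M lborel \<rho>f (\<lambda>r. indicator {\<rho>min..\<rho>max} r / measure lborel {\<rho>min..\<rho>max})"
  shows "\<exists>!x. pure_nash_equilibrium N (action_set W Q L Qmax)
                (expected_utility M \<rho>f N W Q L \<alpha> \<rho>base) x"
proof -
  define k where "k = (prob_space.expectation M \<rho>f - \<rho>base) / \<alpha>"
  define b where "b T n = max (x_min W Q L n) (min (x_max W Q L Qmax n) (k - T))" for T n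
  have le: "x_min W Q L n \<le> x_max W Q L Qmax n" if "n \<in> N" for n
    using assms(3)[OF that] by (simp add: x_min_def x_max_def)
  have nash: "pure_nash_equilibrium N (action_set W Q L Qmax)
        (expected_utility M \<rho>f N W Q L \<alpha> \<rho>base) x \<longleftrightarrow>
      x \<in> (\<Pi>\<^sub>E n\<in>N. action_set W Q L Qmax n) \<and> (\<forall>n\<in>N. x n = b (sum x N) n)" for x
    unfolding b_def k_def
    by (rule nash_iff_fixed_point[OF assms(1,4,5) uniform_integrable[OF assms(7)]])
  have "\<exists>!T. T = sum (b T) N"
    unfolding b_def using le by (rule ex1_fixed_point_sum_projections)
  then obtain T where T: "T = sum (b T) N" and uniq: "\<And>T'. T' = sum (b T') N \<Longrightarrow> T' = T"
    by blast
  show ?thesis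
  proof (rule ex1I)
    \<comment> \<open>The fixed-point equation says that the responses to \<open>T\<close> do
      aggregate to \<open>T\<close>.\<close>
    have "sum (restrict (b T) N) N = T"
      using T by simp
    moreover have "b T n \<in> action_set W Q L Qmax n" if "n \<in> N" for n
      using le[OF that] by (simp add: b_def action_set_def)
    ultimately show "pure_nash_equilibrium N (action_set W Q L Qmax)
        (expected_utility M \<rho>f N W Q L \<alpha> \<rho>base) (restrict (b T) N)"
      by (simp add: nash)
  next
    fix x assume "pure_nash_equilibrium N (action_set W Q L Qmax)
        (expected_utility M \<rho>f N W Q L \<alpha> \<rho>base) x"
    then have x: "x \<in> (\<Pi>\<^sub>E n\<in>N. action_set W Q L Qmax n)" "\<And>n. n \<in> N \<Longrightarrow> x n = b (sum x N) n"
      by (simp_all add: nash)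
    \<comment> \<open>Summing the response equations makes the aggregate of \<open>x\<close> a fixed
      point; knowing it determines every \<open>x n\<close>.\<close>
    have "sum x N = T"
      using x(2) by (intro uniq sum.cong) auto
    then show "x = restrict (b T) N"
      using x by (intro extensionalityI[of _ N]) (auto simp: PiE_iff)
  qed
qed

end
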